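(* There are absolute constants $c>0$ and $C\ge 0$ such that for every finite convex set $A\subset\mathbb{R}$ with $|A|\ge 2$, \[ |A-A|\ge c\,\frac{|A|^{8/5}}{(\log|A|)^{C}}. \]
   Context: A finite set $A=\{a_1<a_2<\dots<a_k\}\subset\mathbb{R}$ is convex if $a_i-a_{i-1}<a_{i+1}-a_i$ for all $1<i<k$. $A-A=\{a-b:a,b\in A\}$. *)

theory Defs
  imports Complex_Main
begin

definition convex_set :: "real set \<Rightarrow> bool" where
  "convex_set A \<longleftrightarrow> finite A \<and>
     (let a = sorted_list_of_set A in
       \<forall>i. 0 < i \<and> i + 1 < length a \<longrightarrow> a ! i - a ! (i - 1) < a ! (i + 1) - a ! i)"

definition diff_set :: "real set \<Rightarrow> real set" where
  "diff_set A = {x - y | x y. x \<in> A \<and> y \<in> A}"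

end

theory Submission
  imports Defs "HOL-Analysis.Analysis"
begin

text \<open>
  Write \<open>r(x)\<close> for the number of representations \<open>x = a - b\<close> with \<open>a \<in> A\<close>, \<open>b \<in> B\<close>, where
  \<open>A\<close> is convex. The first step is the bound \<open>\<bar>{x. r(x) \<ge> t}\<bar> \<lesssim> \<bar>A\<bar> \<bar>B\<bar>\<^sup>2 / t\<^sup>3\<close>, which is
  usually taken from the Szemeredi-Trotter theorem but has an elementary proof: if \<open>x\<close> has
  \<open>t\<close> representations, then a positive proportion of them have a neighbour \<open>(a', b')\<close> at rank
  distance \<open>\<lesssim> \<bar>A\<bar> / t\<close> in \<open>A\<close> and \<open>\<lesssim> \<bar>B\<bar> / t\<close> in \<open>B\<close>. Since \<open>a' - a = b' - b\<close>
  and gaps of a given rank width in a convex set are distinct, \<open>b\<close> and the two rank distances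
  determine \<open>a\<close>, hence \<open>x\<close>.

  The bound controls the third energy, \<open>E\<^sub>3(A, B) \<lesssim> \<bar>A\<bar> \<bar>B\<bar>\<^sup>2 log \<bar>A\<bar>\<close>, and by Cauchy-Schwarz
  also the second one. With \<open>D = A - A\<close> and \<open>A\<^sub>s = {b \<in> A. b + s \<in> A}\<close> one then argues as
  Schoen and Shkredov: the energies of \<open>A\<close> with \<open>A\<^sub>s\<close> sum over \<open>s\<close> to \<open>E\<^sub>3(A)\<close>,
  while \<open>A - A\<^sub>s \<subseteq> D \<inter> (D + s)\<close> (Katz-Koester). Restricting to the popular \<open>s\<close>, those with
  \<open>\<bar>A\<^sub>s\<bar> \<ge> \<bar>A\<bar>\<^sup>2 / (2 \<bar>D\<bar>)\<close>, makes the sum of \<open>\<bar>D \<inter> (D + s)\<bar>\<close> at most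
  \<open>2 \<bar>D\<bar> E(A, D) / \<bar>A\<bar>\<^sup>2\<close>, and Cauchy-Schwarz over \<open>s\<close> gives
  \<open>\<bar>A\<bar>\<^sup>8 \<lesssim> \<bar>D\<bar>\<^sup>5 (log \<bar>A\<bar>)\<^sup>3\<close>.
\<close>

section \<open>Ranks and the gaps of a convex set\<close>

definition rank_in :: "real set \<Rightarrow> real \<Rightarrow> nat" where
  "rank_in B b = card {y \<in> B. y < b}"

text \<open>Its size is \<open>r(x)\<close>, a representation being recorded by \<open>b\<close>
  alone. For \<open>B = A\<close> it is the set \<open>A\<^sub>s\<close>.\<close>

definition shift_set :: "real set \<Rightarrow> real set \<Rightarrow> real \<Rightarrow> real set" where
  "shift_set A B x = {b \<in> B. b + x \<in> A}"

definition differences :: "real set \<Rightarrow> real set \<Rightarrow> real set" where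
  "differences A B = (\<lambda>(a, b). a - b) ` (A \<times> B)"

lemma rank_less: "rank_in B b < rank_in B c" if "finite B" "b \<in> B" "b < c"
  unfolding rank_in_def by (rule psubset_card_mono) (use that in auto)

lemma rank_mono: "rank_in B b \<le> rank_in B c" if "finite B" "b \<le> c"
  unfolding rank_in_def by (rule card_mono) (use that in auto)

lemma rank_inj: "b = c" if "finite B" "b \<in> B" "c \<in> B" "rank_in B b = rank_in B c"
  using rank_less[of B b c] rank_less[of B c b] that by (metis less_irrefl linorder_neqE)

lemma rank_less_card: "rank_in B b < card B" if "finite B" "b \<in> B"
  unfolding rank_in_def by (rule psubset_card_mono) (use that in auto)

lemma nth_sorted_list_of_set_rank:
  assumes "finite B" "b \<in> B"
  shows "sorted_list_of_set B ! rank_in B b = b"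
proof -
  let ?l = "sorted_list_of_set B"
  obtain i where i: "i < length ?l" "?l ! i = b"
    using assms by (metis in_set_conv_nth set_sorted_list_of_set)
  have mono: "?l ! j < ?l ! k \<longleftrightarrow> j < k" if "j < length ?l" "k < length ?l" for j k
    using that strict_sorted_list_of_set[of B]
    by (metis linorder_neqE_nat order_less_imp_not_less sorted_wrt_nth_less order_less_irrefl)
  have "{y \<in> B. y < b} = (\<lambda>j. ?l ! j) ` {..<i}"
  proof (intro equalityI subsetI)
    fix y assume y: "y \<in> {y \<in> B. y < b}"
    then obtain j where "j < length ?l" "?l ! j = y"
      using assms by (metis (lifting) in_set_conv_nth set_sorted_list_of_set mem_Collect_eq)
    with y i mono[of j i] show "y \<in> (\<lambda>j. ?l ! j) ` {..<i}" by auto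
  next
    fix y assume "y \<in> (\<lambda>j. ?l ! j) ` {..<i}"
    then obtain j where j: "j < i" "y = ?l ! j" by auto
    then have "?l ! j \<in> set ?l" using i by (intro nth_mem) auto
    with j i mono[of j i] assms show "y \<in> {y \<in> B. y < b}" by auto
  qed
  moreover have "inj_on (\<lambda>j. ?l ! j) {..<i}"
    using i distinct_sorted_list_of_set[of B] by (auto simp: inj_on_def nth_eq_iff_index_eq)
  ultimately have "rank_in B b = i" by (simp add: rank_in_def card_image)
  with i show ?thesis by simp
qed

text \<open>A gap of rank width \<open>r\<close> is a sum of \<open>r\<close> consecutive steps, and
  the steps increase, so two gaps compare term by term.\<close>

lemma convex_set_gap_less:
  assumes A: "convex_set A" and n: "j + r < card A" and "i < j" "0 < r"
  defines "l \<equiv> sorted_list_of_set A"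
  shows "l ! (i + r) - l ! i < l ! (j + r) - l ! j"
proof -
  define g where "g k = l ! Suc k - l ! k" for k
  have fin: "finite A" using A by (simp add: convex_set_def)
  have len: "length l = card A" using fin by (simp add: l_def)
  have step: "g k < g (Suc k)" if "Suc (Suc k) < card A" for k
    using A that len unfolding convex_set_def Let_def l_def[symmetric] g_def
    by (elim conjE allE[of _ "Suc k"]) auto
  have gm: "g k < g (k + Suc d)" if "k + Suc d + 1 < card A" for k d
    using that
  proof (induction d)
    case 0 then show ?case using step[of k] by simp
  next
    case (Suc d) then show ?case using step[of "k + Suc d"] by simp
  qed
  have tel: "l ! (k + r) - l ! k = (\<Sum>q<r. g (k + q))" for k
    using sum_lessThan_telescope[of "\<lambda>q. l ! (k + q)" r] by (simp add: g_def)
  obtain d where d: "j = i + Suc d" using \<open>i < j\<close> less_imp_Suc_add by auto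
  have "(\<Sum>q<r. g (i + q)) < (\<Sum>q<r. g (j + q))"
  proof (rule sum_strict_mono)
    show "{..<r} \<noteq> {}" using \<open>0 < r\<close> by auto
    fix q assume "q \<in> {..<r}"
    then show "g (i + q) < g (j + q)" using gm[of "i + q" d] n d by (simp add: ac_simps)
  qed simp
  then show ?thesis by (simp add: tel)
qed

text \<open>Gaps of one rank width grow strictly with their left end, so the length fixes that end.
  Truncated subtraction is harmless since both pairs increase.\<close>

lemma convex_set_determined_by_gap:
  assumes A: "convex_set A" and mem: "a \<in> A" "a' \<in> A" "b \<in> A" "b' \<in> A"
    and "a < a'" and diff: "a' - a = b' - b"
    and rk: "rank_in A a' - rank_in A a = rank_in A b' - rank_in A b"
  shows "a = b"
proof -
  have fin: "finite A" using A by (simp add: convex_set_def)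
  have False if mem: "u \<in> A" "u' \<in> A" "v \<in> A" "v' \<in> A" and "u < v" "u < u'"
    and diff: "u' - u = v' - v" and rk: "rank_in A u' - rank_in A u = rank_in A v' - rank_in A v" for u u' v v'
  proof -
    let ?r = "rank_in A u' - rank_in A u"
    have less: "rank_in A u < rank_in A v" "rank_in A u < rank_in A u'" "rank_in A v < rank_in A v'"
      using that rank_less[OF fin] by auto
    have "rank_in A v + ?r < card A" using rank_less_card[OF fin, of v'] mem rk less by simp
    moreover have "rank_in A u + ?r = rank_in A u'" "rank_in A v + ?r = rank_in A v'"
      using less rk by linarith+
    moreover have "0 < ?r" using less by simp
    ultimately have "sorted_list_of_set A ! rank_in A u' - sorted_list_of_set A ! rank_in A u
        < sorted_list_of_set A ! rank_in A v' - sorted_list_of_set A ! rank_in A v"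
      using convex_set_gap_less[OF A _ less(1), of ?r] by metis
    with diff show False by (simp add: nth_sorted_list_of_set_rank fin mem)
  qed
  from this[of a a' b b'] this[of b b' a a'] show ?thesis
    using assms by (cases a b rule: linorder_cases) auto
qed

section \<open>Representations of a difference\<close>

lemma finite_shift_set [simp]: "finite B \<Longrightarrow> finite (shift_set A B x)"
  by (simp add: shift_set_def)

lemma finite_differences [simp]: "finite A \<Longrightarrow> finite B \<Longrightarrow> finite (differences A B)"
  by (simp add: differences_def)

lemma card_differences_le:
  "finite A \<Longrightarrow> finite B \<Longrightarrow> card (differences A B) \<le> card A * card B"
  unfolding differences_def by (metis card_cartesian_product card_image_le finite_cartesian_product)

lemma card_shift_set_le:
  assumes "finite A" "finite B"
  shows "card (shift_set A B x) \<le> card A" "card (shift_set A B x) \<le> card B"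
proof -
  show "card (shift_set A B x) \<le> card A"
    by (rule card_inj_on_le[where f = "\<lambda>b. b + x"]) (use assms in \<open>auto simp: shift_set_def\<close>)
  show "card (shift_set A B x) \<le> card B"
    by (rule card_mono) (use assms in \<open>auto simp: shift_set_def\<close>)
qed

lemma sum_card_shift_set:
  assumes "finite A" "finite B"
  shows "(\<Sum>x\<in>differences A B. card (shift_set A B x)) = card A * card B"
proof -
  have "card A * card B = card (A \<times> B)" by (simp add: card_cartesian_product)
  also have "\<dots> = card (SIGMA x:differences A B. shift_set A B x)"
    by (rule bij_betw_same_card[where f = "\<lambda>(a, b). (a - b, b)"],
        rule bij_betw_byWitness[where f' = "\<lambda>(x, b). (b + x, b)"])
      (auto simp: differences_def shift_set_def)
  finally show ?thesis using assms by simp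
qed

section \<open>Rich differences\<close>

text \<open>Double counting of the pairs \<open>(x, b)\<close> with \<open>b \<in> G x\<close>: at
  least \<open>t / 4\<close> for each rich \<open>x\<close>, and at most
  \<open>card B * M * L\<close> in all by injectivity.\<close>

lemma card_rich_le:
  assumes A: "convex_set A" and B: "finite B" and t: "1 \<le> t"
  shows "real (card {x \<in> differences A B. t \<le> card (shift_set A B x)})
           \<le> 100 * real (card A) * (real (card B))\<^sup>2 / real t ^ 3"
proof -
  let ?n = "card A" and ?m = "card B"
  define X where "X = {x \<in> differences A B. t \<le> card (shift_set A B x)}"
  have fin: "finite A" using A by (simp add: convex_set_def)
  have finX: "finite X" using fin B by (simp add: X_def)
  \<comment> \<open>For \<open>t < 4\<close> the trivial bound \<open>card A * card B\<close>
    suffices; \<open>4 \<le> t\<close> later absorbs a rounding loss.\<close>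
  consider "X = {}" | "t < 4" "X \<noteq> {}" | "4 \<le> t" "X \<noteq> {}" by linarith
  then have "real (card X) \<le> 100 * real ?n * (real ?m)\<^sup>2 / real t ^ 3"
  proof cases
    case 1 then show ?thesis by simp
  next
    case 2
    have "real t ^ 3 \<le> 4 ^ 3" using 2 by (intro power_mono) auto
    then have t3: "real t ^ 3 \<le> 100" by simp
    have "card X \<le> card (differences A B)"
      using fin B by (intro card_mono) (auto simp: X_def)
    also have "\<dots> \<le> ?n * ?m" using fin B by (rule card_differences_le)
    also have "\<dots> \<le> ?n * ?m\<^sup>2" by (simp add: power2_eq_square)
    finally have c: "real (card X) \<le> real ?n * (real ?m)\<^sup>2"
      by (metis of_nat_le_iff of_nat_mult of_nat_power)
    have "real (card X) * real t ^ 3 \<le> (real ?n * (real ?m)\<^sup>2) * 100"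
      by (rule mult_mono[OF c t3]) auto
    with t show ?thesis by (simp add: pos_le_divide_eq mult_ac)
  next
    case 3
    have tn: "t \<le> ?n" and tm: "t \<le> ?m"
      using 3 card_shift_set_le[OF fin B] by (auto simp: X_def intro: order_trans)
    \<comment> \<open>With these block lengths each quotient of a rank is at most
      \<open>t / 4\<close>; the \<open>+ 1\<close> makes \<open>4 * card A < t * L\<close>.\<close>
    define L where "L = 4 * ?n div t + 1"
    define M where "M = 4 * ?m div t + 1"
    \<comment> \<open>Both ranks increase with \<open>b\<close>, so equality of the sums means equality of both quotients,
      while the sum takes only about \<open>t / 2\<close> values.\<close>
    define cell where "cell x b = rank_in A (b + x) div L + rank_in B b div M" for x b
    define G where "G x = {b \<in> shift_set A B x. \<exists>b'\<in>shift_set A B x. b < b' \<and> cell x b = cell x b'}" for x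
    have few_cells: "4 * ((k - 1) div (4 * k div t + 1)) \<le> t" for k
    proof -
      let ?q = "4 * k div t + 1"
      have "4 * k < t * ?q" using t by (metis Suc_eq_plus1 div_less_iff_less_mult lessI mult.commute zero_less_one order_less_le_trans)
      moreover have "(k - 1) div ?q * ?q \<le> k" using div_times_less_eq_dividend[of "k-1" ?q] by linarith
      ultimately have "4 * ((k - 1) div ?q) * ?q \<le> t * ?q" by linarith
      then show ?thesis by (metis mult_le_cancel2 add_gr_0 zero_less_one)
    qed
    have cellbound: "cell x b \<le> t div 2" if "b \<in> shift_set A B x" for x b
    proof -
      have "rank_in A (b + x) \<le> ?n - 1" "rank_in B b \<le> ?m - 1"
        using that rank_less_card[OF fin, of "b + x"] rank_less_card[OF B, of b]
        by (auto simp: shift_set_def)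
      then have "cell x b \<le> (?n - 1) div L + (?m - 1) div M"
        unfolding cell_def by (intro add_mono div_le_mono)
      then show ?thesis using few_cells[of ?n] few_cells[of ?m] unfolding L_def M_def by linarith
    qed
    have cardG: "t \<le> 4 * card (G x)" if x: "x \<in> X" for x
    proof -
      let ?S = "shift_set A B x"
      \<comment> \<open>Outside \<open>G x\<close> no two elements share a cell, and there are at
        most \<open>t div 2 + 1\<close> cells; as \<open>4 \<le> t\<close>, at least
        \<open>t / 4\<close> elements remain.\<close>
      have "card (?S - G x) \<le> card {..t div 2}"
      proof (rule card_inj_on_le)
        show "inj_on (cell x) (?S - G x)"
          by (rule linorder_inj_onI) (auto simp: G_def)
        show "cell x ` (?S - G x) \<subseteq> {..t div 2}" using cellbound by auto
      qed simp
      moreover have "card (?S - G x) = card ?S - card (G x)"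
        by (rule card_Diff_subset) (use B in \<open>auto simp: G_def\<close>)
      moreover have "t \<le> card ?S" using x by (simp add: X_def)
      ultimately show ?thesis using 3 by simp
    qed
    define p where "p x b = (SOME b'. b' \<in> shift_set A B x \<and> b < b' \<and> cell x b = cell x b')" for x b
    have p: "p x b \<in> shift_set A B x" "b < p x b" "cell x b = cell x (p x b)" if "b \<in> G x" for x b
      using that someI_ex[of "\<lambda>b'. b' \<in> shift_set A B x \<and> b < b' \<and> cell x b = cell x b'"]
      unfolding G_def p_def by blast+
    have same: "rank_in A (p x b + x) - rank_in A (b + x) < L" "rank_in B (p x b) - rank_in B b < M"
      if b: "b \<in> G x" for x b
    proof -
      have le: "rank_in A (b + x) \<le> rank_in A (p x b + x)" "rank_in B b \<le> rank_in B (p x b)"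
        using p[OF b] fin B by (auto intro!: rank_mono)
      have "rank_in A (b + x) div L \<le> rank_in A (p x b + x) div L" "rank_in B b div M \<le> rank_in B (p x b) div M"
        using le by (auto intro: div_le_mono)
      with p(3)[OF b] have eq: "rank_in A (b + x) div L = rank_in A (p x b + x) div L"
          "rank_in B b div M = rank_in B (p x b) div M" unfolding cell_def by linarith+
      have close: "v - u < q" if "u div q = v div q" "0 < q" for u v q :: nat
      proof -
        have "v - u \<le> v mod q" using that
          by (metis (no_types) add_diff_cancel_left' diff_le_mono2 div_mult_mod_eq le_diff_conv
              le_add1 mult.commute)
        also have "\<dots> < q" using that by simp
        finally show ?thesis .
      qed
      show "rank_in A (p x b + x) - rank_in A (b + x) < L" "rank_in B (p x b) - rank_in B b < M"
        using close[OF eq(1)] close[OF eq(2)] by (auto simp: L_def M_def)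
    qed
    let ?f = "\<lambda>(x, b). (b, rank_in B (p x b) - rank_in B b, rank_in A (p x b + x) - rank_in A (b + x))"
    have G_sub: "G x \<subseteq> B" for x by (auto simp: G_def shift_set_def)
    have finG: "finite (G x)" for x using B by (simp add: G_def)
    have "card (SIGMA x:X. G x) \<le> card (B \<times> {..<M} \<times> {..<L})"
    proof (rule card_inj_on_le[where f = ?f])
      show "inj_on ?f (SIGMA x:X. G x)"
      proof (rule inj_onI)
        fix xb yc assume mem: "xb \<in> (SIGMA x:X. G x)" "yc \<in> (SIGMA x:X. G x)" and f_eq: "?f xb = ?f yc"
        obtain x b y c where pairs: "xb = (x, b)" "yc = (y, c)" by (metis surj_pair)
        then have G: "b \<in> G x" "c \<in> G y"
          and bc: "b = c" and rB: "rank_in B (p x b) - rank_in B b = rank_in B (p y c) - rank_in B c"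
          and rA: "rank_in A (p x b + x) - rank_in A (b + x) = rank_in A (p y c + y) - rank_in A (c + y)"
          using mem f_eq by auto
        note px = p[OF G(1)] note py = p[OF G(2)]
        have mem: "b \<in> B" "b + x \<in> A" "c + y \<in> A" "p x b \<in> B" "p x b + x \<in> A" "p y c \<in> B" "p y c + y \<in> A"
          using G px py by (auto simp: G_def shift_set_def)
        have "rank_in B b < rank_in B (p x b)" "rank_in B c < rank_in B (p y c)"
          using mem px py B bc by (auto intro!: rank_less)
        with rB have "rank_in B (p x b) = rank_in B (p y c)"
          unfolding bc by linarith
        then have eq: "p x b = p y c" using rank_inj[OF B] mem by blast
        \<comment> \<open>Translating the common gap \<open>p x b - b\<close> by \<open>x\<close>
          and by \<open>y\<close> gives two gaps in \<open>A\<close> of equal length and rank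
          width.\<close>
        have "b + x = c + y"
          by (rule convex_set_determined_by_gap[OF A mem(2,5,3,7)]) (use px bc eq rA in auto)
        with bc show "xb = yc" by (simp add: pairs)
      qed
      show "?f ` (SIGMA x:X. G x) \<subseteq> B \<times> {..<M} \<times> {..<L}"
        using same by (auto intro: subsetD[OF G_sub])
      show "finite (B \<times> {..<M} \<times> {..<L})" using B by simp
    qed
    then have "(\<Sum>x\<in>X. card (G x)) \<le> ?m * (M * L)"
      using finX finG by (simp add: card_cartesian_product)
    moreover have "card X * t \<le> 4 * (\<Sum>x\<in>X. card (G x))"
      using sum_mono[of X "\<lambda>_. t" "\<lambda>x. 4 * card (G x)"] cardG by (simp add: sum_distrib_left)
    ultimately have "card X * t \<le> 4 * (?m * (M * L))" by linarith
    then have main: "real (card X) * real t \<le> 4 * (real ?m * (real M * real L))"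
      by (metis of_nat_le_iff of_nat_mult of_nat_numeral)
    \<comment> \<open>The \<open>+ 1\<close> costs one more \<open>t \<le> k\<close>, hence the
      factors 5 and the constant \<open>100 = 4 * 5 * 5\<close>.\<close>
    have width: "real (4 * k div t + 1) * real t \<le> 5 * real k" if "t \<le> k" for k
    proof -
      have "(4 * k div t + 1) * t \<le> 5 * k"
        using div_times_less_eq_dividend[of "4 * k" t] that
        unfolding add_mult_distrib by linarith
      then show ?thesis by (metis of_nat_le_iff of_nat_mult of_nat_numeral)
    qed
    have "real (card X) * real t ^ 3 = real (card X) * real t * (real t * real t)"
      by (simp add: power3_eq_cube)
    also have "\<dots> \<le> 4 * (real ?m * (real M * real L)) * (real t * real t)"
      using main by (rule mult_right_mono) simp
    also have "\<dots> = 4 * real ?m * ((real M * real t) * (real L * real t))" by simp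
    also have "\<dots> \<le> 4 * real ?m * ((5 * real ?m) * (5 * real ?n))"
      unfolding M_def L_def
      by (rule mult_left_mono[OF mult_mono[OF width[OF tm] width[OF tn]]]) simp_all
    also have "\<dots> = 100 * real ?n * (real ?m)\<^sup>2" by (simp add: power2_eq_square)
    finally show ?thesis using t by (simp add: pos_le_divide_eq)
  qed
  then show ?thesis by (simp add: X_def)
qed

section \<open>Third and second energies\<close>

text \<open>Cauchy-Schwarz for \<open>sqrt (u i)\<close> and \<open>sqrt (v i)\<close>, in a form
  free of roots.\<close>

lemma sum_square_le_sum_mult_sum:
  fixes f u v :: "'a \<Rightarrow> real"
  assumes "\<And>i. i \<in> I \<Longrightarrow> 0 \<le> f i" "\<And>i. i \<in> I \<Longrightarrow> 0 \<le> u i" "\<And>i. i \<in> I \<Longrightarrow> 0 \<le> v i"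
    and le: "\<And>i. i \<in> I \<Longrightarrow> (f i)\<^sup>2 \<le> u i * v i"
  shows "(\<Sum>i\<in>I. f i)\<^sup>2 \<le> (\<Sum>i\<in>I. u i) * (\<Sum>i\<in>I. v i)"
proof -
  have "f i \<le> sqrt (u i) * sqrt (v i)" if "i \<in> I" for i
    using le[OF that] by (metis real_le_rsqrt real_sqrt_mult)
  then have "(\<Sum>i\<in>I. f i)\<^sup>2 \<le> (\<Sum>i\<in>I. sqrt (u i) * sqrt (v i))\<^sup>2"
    using assms by (intro power_mono sum_mono sum_nonneg) auto
  also have "\<dots> \<le> (\<Sum>i\<in>I. (sqrt (u i))\<^sup>2) * (\<Sum>i\<in>I. (sqrt (v i))\<^sup>2)"
    by (rule Cauchy_Schwarz_ineq_sum)
  finally show ?thesis using assms by simp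
qed

text \<open>The cube grows by at most \<open>3 * (k + 1)\<^sup>2\<close> from \<open>k\<close> to
  \<open>k + 1\<close>. This bounds a cube by a sum over thresholds.\<close>

lemma cube_le_sum: "real k ^ 3 \<le> (\<Sum>t=1..k. 3 * (real t)\<^sup>2)"
proof (induction k)
  case (Suc k)
  have "real (Suc k) ^ 3 \<le> real k ^ 3 + 3 * (real (Suc k))\<^sup>2"
    by (simp add: power2_eq_square power3_eq_cube algebra_simps)
  with Suc show ?case by simp
qed simp

text \<open>Summing over thresholds \<open>t\<close>, the bound on rich differences leaves at most
  \<open>300 * card A * (card B)\<^sup>2 / t\<close> at \<open>t\<close>, and
  \<open>r(x) \<le> card A\<close> ends the sum.\<close>

lemma sum_cube_card_shift_set_le:
  assumes A: "convex_set A" and B: "finite B"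
  shows "(\<Sum>x\<in>differences A B. real (card (shift_set A B x)) ^ 3)
           \<le> 300 * real (card A) * (real (card B))\<^sup>2 * harm (card A)"
proof -
  let ?n = "card A" and ?m = "card B" and ?D = "differences A B"
  let ?r = "\<lambda>x. card (shift_set A B x)"
  have fin: "finite A" using A by (simp add: convex_set_def)
  have "real (?r x) ^ 3 \<le> (\<Sum>t=1..?n. if t \<le> ?r x then 3 * (real t)\<^sup>2 else 0)" for x
  proof -
    have "real (?r x) ^ 3 \<le> (\<Sum>t=1..?r x. 3 * (real t)\<^sup>2)" by (rule cube_le_sum)
    also have "{1..?r x} = {1..?n} \<inter> {t. t \<le> ?r x}"
      using card_shift_set_le(1)[OF fin B, of x] by auto
    finally show ?thesis by (simp add: sum.inter_restrict)
  qed
  then have "(\<Sum>x\<in>?D. real (?r x) ^ 3)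
      \<le> (\<Sum>x\<in>?D. \<Sum>t=1..?n. if t \<le> ?r x then 3 * (real t)\<^sup>2 else 0)"
    by (rule sum_mono)
  also have "\<dots> = (\<Sum>t=1..?n. \<Sum>x\<in>?D. if t \<le> ?r x then 3 * (real t)\<^sup>2 else 0)"
    by (rule sum.swap)
  also have "\<dots> = (\<Sum>t=1..?n. 3 * (real t)\<^sup>2 * real (card {x \<in> ?D. t \<le> ?r x}))"
    using fin B by (intro sum.cong) (auto simp flip: sum.inter_filter)
  also have "\<dots> \<le> (\<Sum>t=1..?n. 300 * real ?n * (real ?m)\<^sup>2 * inverse (real t))"
  proof (rule sum_mono)
    fix t assume t: "t \<in> {1..?n}"
    have "3 * (real t)\<^sup>2 * real (card {x \<in> ?D. t \<le> ?r x})
        \<le> 3 * (real t)\<^sup>2 * (100 * real ?n * (real ?m)\<^sup>2 / real t ^ 3)"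
      using t by (intro mult_left_mono card_rich_le A B) auto
    also have "\<dots> = 300 * real ?n * (real ?m)\<^sup>2 * inverse (real t)"
      using t by (simp add: field_simps power2_eq_square power3_eq_cube)
    finally show "3 * (real t)\<^sup>2 * real (card {x \<in> ?D. t \<le> ?r x})
        \<le> 300 * real ?n * (real ?m)\<^sup>2 * inverse (real t)" .
  qed
  also have "\<dots> = 300 * real ?n * (real ?m)\<^sup>2 * harm ?n"
    by (simp add: harm_def sum_distrib_left)
  finally show ?thesis .
qed

text \<open>Interpolation between the first moment \<open>card A * card B\<close> and the third; the
  outer square avoids roots.\<close>

lemma sum_square_card_shift_set_le:
  assumes A: "convex_set A" and B: "finite B"
  shows "(\<Sum>x\<in>differences A B. (real (card (shift_set A B x)))\<^sup>2)\<^sup>2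
           \<le> 300 * (real (card A))\<^sup>2 * real (card B) ^ 3 * harm (card A)"
proof -
  let ?n = "card A" and ?m = "card B" and ?D = "differences A B"
  let ?r = "\<lambda>x. card (shift_set A B x)"
  have fin: "finite A" using A by (simp add: convex_set_def)
  have "(\<Sum>x\<in>?D. (real (?r x))\<^sup>2)\<^sup>2 \<le> (\<Sum>x\<in>?D. real (?r x)) * (\<Sum>x\<in>?D. real (?r x) ^ 3)"
    by (rule sum_square_le_sum_mult_sum) (auto simp: power_numeral_reduce)
  also have "(\<Sum>x\<in>?D. real (?r x)) = real ?n * real ?m"
    using sum_card_shift_set[OF fin B] by (metis of_nat_mult of_nat_sum)
  also have "real ?n * real ?m * (\<Sum>x\<in>?D. real (?r x) ^ 3)
      \<le> real ?n * real ?m * (300 * real ?n * (real ?m)\<^sup>2 * harm ?n)"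
    by (intro mult_left_mono sum_cube_card_shift_set_le A B) auto
  finally show ?thesis by (simp add: power2_eq_square power3_eq_cube mult_ac)
qed

section \<open>Energies and differences of the sets \<open>A\<^sub>s\<close>\<close>

lemma diff_set_eq_differences: "diff_set A = differences A A"
  by (auto simp: diff_set_def differences_def)

text \<open>Both sides count triples of pairs in \<open>A\<close> with a common difference; the two
  parameters of the left side are the offsets between the three pairs.\<close>
lemma sum_energy_shift_set_le:
  assumes "finite A"
  shows "(\<Sum>s\<in>differences A A. \<Sum>y\<in>differences A (shift_set A A s).
            (card (shift_set A (shift_set A A s) y))\<^sup>2)
          \<le> (\<Sum>x\<in>differences A A. card (shift_set A A x) ^ 3)"
proof -
  let ?D = "differences A A" and ?A = "shift_set A A"
  let ?L = "SIGMA s:?D. SIGMA y:differences A (?A s). shift_set A (?A s) y \<times> shift_set A (?A s) y"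
  let ?R = "SIGMA x:?D. ?A x \<times> ?A x \<times> ?A x"
  let ?f = "\<lambda>(s, y, b, b'). (b' - b, b, b + y, b + s)"
  have "card ?L \<le> card ?R"
  proof (rule card_inj_on_le)
    show "inj_on ?f ?L" by (auto simp: inj_on_def)
    show "?f ` ?L \<subseteq> ?R"
      by (force simp: shift_set_def differences_def algebra_simps)
    show "finite ?R" using assms by simp
  qed
  then show ?thesis
    using assms by (simp add: card_cartesian_product power2_eq_square power3_eq_cube mult_ac)
qed

text \<open>Katz-Koester: \<open>(a - b) - s = a - (b + s)\<close>. The sign in \<open>- s\<close>
  makes the right side \<open>D \<inter> (D + s)\<close>.\<close>

lemma differences_shift_set_subset:
  "differences A (shift_set A A s) \<subseteq> shift_set (differences A A) (differences A A) (- s)"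
proof
  fix x assume "x \<in> differences A (shift_set A A s)"
  then obtain a b where x: "x = a - b" and mem: "a \<in> A" "b \<in> A" "b + s \<in> A"
    by (auto simp: differences_def shift_set_def)
  then have "x + - s = a - (b + s)" by simp
  with mem have "x + - s \<in> differences A A" unfolding differences_def by (intro image_eqI[of _ _ "(a, b + s)"]) auto
  moreover have "x \<in> differences A A" using x mem by (auto simp: differences_def)
  ultimately show "x \<in> shift_set (differences A A) (differences A A) (- s)"
    by (simp add: shift_set_def)
qed

text \<open>By \<open>(a + s) - d = a - (d - s)\<close> each triple \<open>(s, a, d)\<close> on the
  left gives two representations of one difference, and these determine the triple.\<close>

lemma sum_card_mult_card_le:
  assumes "finite A" "finite B"
  shows "(\<Sum>s\<in>S. card (shift_set A A s) * card (shift_set B B (- s)))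
          \<le> (\<Sum>x\<in>differences A B. (card (shift_set A B x))\<^sup>2)"
proof (cases "finite S")
  case True
  let ?L = "SIGMA s:S. shift_set A A s \<times> shift_set B B (- s)"
  let ?R = "SIGMA x:differences A B. shift_set A B x \<times> shift_set A B x"
  let ?f = "\<lambda>(s, a, d). (a + s - d, d, d - s)"
  have "card ?L \<le> card ?R"
  proof (rule card_inj_on_le)
    show "inj_on ?f ?L" by (auto simp: inj_on_def)
    show "?f ` ?L \<subseteq> ?R"
      by (force simp: shift_set_def differences_def algebra_simps)
    show "finite ?R" using assms by simp
  qed
  then show ?thesis
    using assms True by (simp add: card_cartesian_product power2_eq_square)
qed simp

section \<open>Combining the energies over popular differences\<close>

lemma card_pow8_le:
  assumes A: "convex_set A" and "A \<noteq> {}"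
  shows "real (card A) ^ 8 \<le> 64 * 300 ^ 3 * harm (card A) ^ 3 * real (card (diff_set A)) ^ 5"
proof -
  let ?D = "differences A A" and ?A = "shift_set A A"
  define n where "n = real (card A)"
  define d where "d = real (card ?D)"
  define H where "H = (harm (card A) :: real)"
  define a where "a s = real (card (?A s))" for s
  define u where "u s = real (card (shift_set ?D ?D (- s)))" for s
  define v where "v s = (\<Sum>y\<in>differences A (?A s). (real (card (shift_set A (?A s) y)))\<^sup>2)" for s
  define E2 where "E2 = (\<Sum>x\<in>differences A ?D. (real (card (shift_set A ?D x)))\<^sup>2)"
  \<comment> \<open>The threshold is half the mean of \<open>a\<close> over the differences, so
    unpopular \<open>s\<close> carry at most half of the mass \<open>n\<^sup>2\<close>.\<close>
  define P where "P = {s \<in> ?D. n\<^sup>2 \<le> 2 * d * a s}"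
  have fin: "finite A" using A by (simp add: convex_set_def)
  have finD: "finite ?D" using fin by simp
  have n0: "0 < n" using fin \<open>A \<noteq> {}\<close> by (auto simp: n_def card_gt_0_iff)
  have d0: "0 < d" using fin \<open>A \<noteq> {}\<close> by (auto simp: d_def card_gt_0_iff differences_def)
  have H0: "0 \<le> H" by (simp add: H_def harm_nonneg)
  have nonneg: "0 \<le> a s" "0 \<le> u s" "0 \<le> v s" for s
    by (auto simp: a_def u_def v_def intro: sum_nonneg)
  have "(\<Sum>s\<in>?D. a s) = n\<^sup>2"
    using sum_card_shift_set[OF fin fin]
    by (metis (no_types, lifting) a_def n_def of_nat_mult of_nat_sum power2_eq_square sum.cong)
  moreover have "(\<Sum>s\<in>?D. a s) = (\<Sum>s\<in>P. a s) + (\<Sum>s\<in>?D - P. a s)"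
    using finD by (metis (no_types, lifting) P_def add.commute mem_Collect_eq subsetI sum.subset_diff)
  moreover have "(\<Sum>s\<in>?D - P. a s) \<le> n\<^sup>2 / 2"
  proof -
    have "(\<Sum>s\<in>?D - P. a s) \<le> (\<Sum>s\<in>?D - P. n\<^sup>2 / (2 * d))"
      using d0 by (intro sum_mono) (auto simp: P_def field_simps)
    also have "\<dots> \<le> (\<Sum>s\<in>?D. n\<^sup>2 / (2 * d))"
      using finD d0 by (intro sum_mono2) auto
    also have "\<dots> = n\<^sup>2 / 2" using d0 by (simp flip: d_def)
    finally show ?thesis .
  qed
  ultimately have "n\<^sup>2 / 2 \<le> (\<Sum>s\<in>P. a s)" by linarith
  then have "n * (n\<^sup>2 / 2) \<le> n * (\<Sum>s\<in>P. a s)" using n0 by (intro mult_left_mono) auto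
  then have "n ^ 3 / 2 \<le> (\<Sum>s\<in>P. n * a s)"
    by (simp add: sum_distrib_left power2_eq_square power3_eq_cube)
  then have "(n ^ 3 / 2)\<^sup>2 \<le> (\<Sum>s\<in>P. n * a s)\<^sup>2" using n0 by (intro power_mono) auto
  \<comment> \<open>Cauchy-Schwarz over \<open>s\<close>; its pointwise hypothesis is Cauchy-Schwarz
    over the differences of \<open>A\<close> and \<open>A\<^sub>s\<close>, of which there are at
    most \<open>u s\<close>.\<close>
  also have "\<dots> \<le> (\<Sum>s\<in>P. u s) * (\<Sum>s\<in>P. v s)"
  proof (rule sum_square_le_sum_mult_sum)
    fix s
    let ?S = "differences A (?A s)"
    have "n * a s = (\<Sum>y\<in>?S. real (card (shift_set A (?A s) y)))"
      using sum_card_shift_set[OF fin, of "?A s"] fin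
      by (simp add: n_def a_def flip: of_nat_mult of_nat_sum)
    also have "\<dots>\<^sup>2 \<le> (\<Sum>y\<in>?S. 1) * v s"
      unfolding v_def by (rule sum_square_le_sum_mult_sum) auto
    also have "(\<Sum>y\<in>?S. 1) * v s \<le> u s * v s"
      using differences_shift_set_subset[of A s] fin nonneg
      by (intro mult_right_mono) (auto simp: u_def intro!: card_mono)
    finally show "(n * a s)\<^sup>2 \<le> u s * v s" .
  qed (use n0 nonneg in auto)
  finally have main: "n ^ 6 / 4 \<le> (\<Sum>s\<in>P. u s) * (\<Sum>s\<in>P. v s)"
    by (simp add: power_divide flip: power_mult)
  have "(\<Sum>s\<in>P. v s) \<le> (\<Sum>s\<in>?D. v s)"
    using finD nonneg by (intro sum_mono2) (auto simp: P_def)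
  also have "\<dots> \<le> (\<Sum>x\<in>?D. real (card (?A x)) ^ 3)"
    using sum_energy_shift_set_le[OF fin] unfolding v_def
    by (simp flip: of_nat_power of_nat_sum)
  also have "\<dots> \<le> 300 * n ^ 3 * H"
    using sum_cube_card_shift_set_le[OF A fin]
    by (simp add: n_def H_def power2_eq_square power3_eq_cube mult_ac)
  finally have V: "(\<Sum>s\<in>P. v s) \<le> 300 * n ^ 3 * H" .
  \<comment> \<open>Popularity trades \<open>n\<^sup>2\<close> for \<open>2 * d * a s\<close>, and
    the weighted sum is bounded by an energy of \<open>A\<close> with \<open>D\<close>.\<close>
  have "n\<^sup>2 * (\<Sum>s\<in>P. u s) = (\<Sum>s\<in>P. n\<^sup>2 * u s)" by (rule sum_distrib_left)
  also have "\<dots> \<le> (\<Sum>s\<in>P. 2 * d * a s * u s)"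
    using nonneg by (intro sum_mono mult_right_mono) (auto simp: P_def)
  also have "\<dots> = 2 * d * (\<Sum>s\<in>P. a s * u s)" by (simp add: sum_distrib_left mult_ac)
  also have "\<dots> \<le> 2 * d * E2"
    using sum_card_mult_card_le[OF fin finD, of P] d0
    unfolding a_def u_def E2_def by (intro mult_left_mono) (simp_all flip: of_nat_mult of_nat_power of_nat_sum)
  finally have U: "n\<^sup>2 * (\<Sum>s\<in>P. u s) \<le> 2 * d * E2" .
  have E2: "E2\<^sup>2 \<le> 300 * n\<^sup>2 * d ^ 3 * H"
    using sum_square_card_shift_set_le[OF A finD] by (simp add: E2_def n_def d_def H_def)
  have E2_nonneg: "0 \<le> E2" by (simp add: E2_def sum_nonneg)
  have "n\<^sup>2 * (n ^ 6 / 4) \<le> n\<^sup>2 * ((\<Sum>s\<in>P. u s) * (\<Sum>s\<in>P. v s))"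
    using main by (intro mult_left_mono) auto
  also have "\<dots> \<le> (2 * d * E2) * (300 * n ^ 3 * H)"
    using mult_mono[OF U V] d0 E2_nonneg nonneg by (simp add: mult.assoc sum_nonneg)
  finally have "n ^ 5 * n ^ 3 \<le> (2400 * d * E2 * H) * n ^ 3"
    by (simp add: mult_ac flip: power_add)
  then have "n ^ 5 \<le> 2400 * d * E2 * H" using n0 by (simp only: mult_le_cancel_right_pos zero_less_power)
  \<comment> \<open>The available bound is on the square of \<open>E2\<close>; the constants combine
    as \<open>2400\<^sup>2 * 300 = 64 * 300 ^ 3\<close>.\<close>
  then have "(n ^ 5)\<^sup>2 \<le> (2400 * d * E2 * H)\<^sup>2" using n0 by (intro power_mono) auto
  also have "\<dots> = 2400\<^sup>2 * d\<^sup>2 * H\<^sup>2 * E2\<^sup>2" by (simp add: power_mult_distrib)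
  also have "\<dots> \<le> 2400\<^sup>2 * d\<^sup>2 * H\<^sup>2 * (300 * n\<^sup>2 * d ^ 3 * H)"
    using E2 by (intro mult_left_mono) auto
  finally have "n ^ 8 * n\<^sup>2 \<le> (64 * 300 ^ 3 * H ^ 3 * d ^ 5) * n\<^sup>2"
    by (simp add: mult_ac power_numeral_reduce)
  then have "n ^ 8 \<le> 64 * 300 ^ 3 * H ^ 3 * d ^ 5"
    using n0 by (simp only: mult_le_cancel_right_pos zero_less_power)
  then show ?thesis by (simp add: n_def H_def d_def diff_set_eq_differences)
qed

section \<open>From harmonic numbers to logarithms\<close>

text \<open>\<open>harm n - ln n\<close> decreases from 1 at \<open>n = 1\<close>, and
  \<open>1 \<le> 2 * ln 2\<close> absorbs that 1.\<close>

lemma harm_le_three_ln: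
  assumes "2 \<le> n"
  shows "harm n \<le> 3 * ln (real n)"
proof -
  obtain m where m: "n = Suc m" using assms by (cases n) auto
  have "harm n - ln (real n) \<le> 1"
    using decseqD[OF decseq_harm_diff_ln, of 0 m] by (simp add: m harm_def)
  moreover have "exp (1/2) \<le> (2::real)"
    using exp_bound[of "1/2"] by (simp add: power2_eq_square)
  then have "1/2 \<le> ln (2::real)" using ln_ge_iff[of 2 "1/2"] by simp
  moreover have "ln 2 \<le> ln (real n)" using assms by simp
  ultimately show ?thesis by linarith
qed

theorem theorem5:
  shows "\<exists>c::real. \<exists>C::real. c > 0 \<and> C \<ge> 0 \<and>
    (\<forall>A::real set. finite A \<and> convex_set A \<and> card A \<ge> 2 \<longrightarrow>
       real (card (diff_set A)) \<ge> c * real (card A) powr (8/5) / (ln (real (card A))) powr C)"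
proof -
  \<comment> \<open>Replacing \<open>harm\<close> by \<open>3 * ln\<close> turns
    \<open>300 ^ 3\<close> into \<open>900 ^ 3\<close>; fifth roots of
    \<open>n ^ 8 \<le> K * l ^ 3 * d ^ 5\<close> give the exponents 8/5 and 3/5.\<close>
  define K :: real where "K = 64 * 900 ^ 3"
  have K: "0 < K" by (simp add: K_def)
  have "real (card (diff_set A)) \<ge> K powr - (1/5) * real (card A) powr (8/5) / (ln (real (card A))) powr (3/5)"
    if A: "finite A" "convex_set A" "card A \<ge> 2" for A
  proof -
    define n where "n = real (card A)"
    define d where "d = real (card (diff_set A))"
    define l where "l = ln n"
    have n: "2 \<le> n" using A by (simp add: n_def)
    then have l: "0 < l" by (simp add: l_def)
    have "A \<noteq> {}" using A by auto
    then have d: "0 < d" using A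
      by (auto simp: d_def card_gt_0_iff diff_set_eq_differences) (auto simp: differences_def)
    have "n ^ 8 \<le> 64 * 300 ^ 3 * harm (card A) ^ 3 * d ^ 5"
      unfolding n_def d_def by (rule card_pow8_le) fact+
    also have "\<dots> \<le> 64 * 300 ^ 3 * (3 * l) ^ 3 * d ^ 5"
      using harm_le_three_ln[OF A(3)] d unfolding l_def n_def
      by (intro mult_left_mono mult_right_mono power_mono harm_nonneg) auto
    also have "\<dots> = K * l ^ 3 * d ^ 5" by (simp add: K_def power_mult_distrib)
    finally have "n powr 8 \<le> K * l powr 3 * d powr 5"
      using n l d by (simp add: powr_numeral)
    then have "(n powr 8) powr (1/5) \<le> (K * l powr 3 * d powr 5) powr (1/5)"
      by (intro powr_mono2) auto
    then have "n powr (8/5) \<le> K powr (1/5) * l powr (3/5) * d"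
      using K l d by (simp add: powr_mult powr_powr del: powr_numeral)
    then have "K powr - (1/5) * n powr (8/5) / l powr (3/5) \<le> d"
      using K l by (simp add: powr_minus field_simps)
    then show ?thesis by (simp add: n_def d_def l_def)
  qed
  with K show ?thesis by (intro exI[of _ "K powr - (1/5)"] exI[of _ "3/5"]) auto
qed

end
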